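(* Let $n,k\ge 1$, let $S=S(X,B_1,\ldots,B_k)$ be an interlaced symmetric word, let $B_1,\ldots,B_k$ be real $n\times n$ positive definite matrices and let $P$ be a real $n\times n$ positive semidefinite matrix. Then there is a real positive semidefinite $n\times n$ matrix $X$ with $S(X,B_1,\ldots,B_k)=P$.
   Context: Real positive definite (semidefinite) matrices are real symmetric matrices with all eigenvalues positive (nonnegative). Words are elements of the free monoid on the letters $X,B_1,\ldots,B_k$. A word is symmetric if it equals its reversal (palindrome). A word is interlaced if it has the form $W=B_{i_1}^{q_1}\prod_{j=1}^{m}X^{p_j}B_{i_{j+1}}^{q_{j+1}}$ with $m\ge 1$, integers $p_j>0$, $q_j\ge 0$ and $i_j\in\{1,\ldots,k\}$ (the zeroth power of a letter is the empty word). $S(X,B_1,\ldots,B_k)$ denotes the matrix product obtained by substituting matrices for letters. *)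

theory Defs
  imports "HOL-Analysis.Analysis"
begin

definition eigenvalue :: "real^'n^'n \<Rightarrow> real \<Rightarrow> bool" where
  "eigenvalue A c \<longleftrightarrow> (\<exists>v. v \<noteq> 0 \<and> A *v v = c *s v)"

(* Only real eigenvalues are quantified over: all eigenvalues of a real symmetric matrix are real. *)

definition positive_definite :: "real^'n^'n \<Rightarrow> bool" where
  "positive_definite A \<longleftrightarrow> transpose A = A \<and> (\<forall>c. eigenvalue A c \<longrightarrow> c > 0)"

definition positive_semidefinite :: "real^'n^'n \<Rightarrow> bool" where
  "positive_semidefinite A \<longleftrightarrow> transpose A = A \<and> (\<forall>c. eigenvalue A c \<longrightarrow> c \<ge> 0)"

(* Words are lists of letters, the monoid product is (@). The alphabet for k is LX, LB 1, ..., LB k;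
   the bound on the indices is imposed by interlaced. *)
datatype letter = LX | LB nat

type_synonym word = "letter list"

definition symmetric_word :: "word \<Rightarrow> bool" where
  "symmetric_word W \<longleftrightarrow> rev W = W"

definition interlaced :: "nat \<Rightarrow> word \<Rightarrow> bool" where
  "interlaced k W \<longleftrightarrow>
     (\<exists>(m::nat) (i :: nat \<Rightarrow> nat) (p :: nat \<Rightarrow> nat) (q :: nat \<Rightarrow> nat).
        m \<ge> 1 \<and> (\<forall>j\<in>{1..m+1}. i j \<in> {1..k}) \<and> (\<forall>j\<in>{1..m}. p j > 0) \<and>
        W = replicate (q 1) (LB (i 1)) @
            concat (map (\<lambda>j. replicate (p j) LX @ replicate (q (j+1)) (LB (i (j+1)))) [1..<m+1]))"

fun letter_matrix :: "real^'n^'n \<Rightarrow> (nat \<Rightarrow> real^'n^'n) \<Rightarrow> letter \<Rightarrow> real^'n^'n" where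
  "letter_matrix X B LX = X"
| "letter_matrix X B (LB j) = B j"

definition word_matrix :: "word \<Rightarrow> real^'n^'n \<Rightarrow> (nat \<Rightarrow> real^'n^'n) \<Rightarrow> real^'n^'n" where
  "word_matrix W X B = foldr (\<lambda>l M. letter_matrix X B l ** M) W (mat 1)"

end

theory Submission
  imports Defs
begin

text \<open>Congruence with \<open>B\<^sub>j\<^sup>-\<^sup>1\<close> strips a \<open>B\<^sub>j\<close> from both ends of the word, so \<open>S\<close> may be assumed to begin and
  end with \<open>X\<close>. Then \<open>S(X)\<close> is positive semidefinite, vanishes on the kernel of \<open>X\<close>, and
  \<open>tr (S(X) X) > 0\<close> for \<open>X \<noteq> 0\<close>, so homogeneity makes \<open>tr ((S(X) - P) X)\<close> positive on a large sphere of
  the cone. By Brouwer's theorem there is a solution \<open>X\<close> of the complementarity problem: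
  \<open>N = S(X) - P\<close> is positive semidefinite and \<open>tr (N X) = 0\<close>, hence \<open>N X = 0\<close>. For \<open>w\<close> in the kernel of
  \<open>X\<close> the value of the form \<open>N\<close> at \<open>w\<close> is minus that of \<open>P\<close>, so \<open>N w = 0\<close>. As \<open>N\<close> vanishes on both the
  range and the kernel of \<open>X\<close>, it is zero. No approximation by positive definite \<open>P\<close> is needed.\<close>

subsection \<open>Quadratic forms of symmetric matrices\<close>

text \<open>Eigenvalues are traded for quadratic forms, which behave well under sums, congruences
  and limits; \<open>positive_semidefinite_iff\<close> links the two.\<close>

definition psd_form :: "real^'n^'n \<Rightarrow> bool" where
  "psd_form A \<longleftrightarrow> transpose A = A \<and> (\<forall>x. 0 \<le> x \<bullet> (A *v x))"

definition pd_form :: "real^'n^'n \<Rightarrow> bool" where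
  "pd_form A \<longleftrightarrow> transpose A = A \<and> (\<forall>x. x \<noteq> 0 \<longrightarrow> 0 < x \<bullet> (A *v x))"

lemma pd_form_imp_psd_form: "pd_form A \<Longrightarrow> psd_form A"
  unfolding pd_form_def psd_form_def
  by (metis inner_zero_left less_eq_real_def)

lemma pd_form_mat_1: "pd_form (mat 1)"
  by (simp add: pd_form_def)

lemma symmetric_inner_eq:
  fixes A :: "real^'n^'n"
  assumes "transpose A = A"
  shows "(A *v x) \<bullet> y = x \<bullet> (A *v y)"
  using assms by (metis dot_lmul_matrix transpose_matrix_vector)

text \<open>If \<open>A *v v\<close> were nonzero, a short move from \<open>v\<close> along its
  negative would make the form negative.\<close>

lemma psd_form_zero_imp_kernel:
  fixes A :: "real^'n^'n"
  assumes A: "psd_form A" and v: "v \<bullet> (A *v v) = 0"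
  shows "A *v v = 0"
proof (rule ccontr)
  assume "A *v v \<noteq> 0"
  define y where "y = A *v v"
  define a where "a = y \<bullet> y"
  define b where "b = y \<bullet> (A *v y)"
  have a: "a > 0" using \<open>A *v v \<noteq> 0\<close> by (simp add: a_def y_def)
  have b: "b \<ge> 0" using A by (simp add: b_def psd_form_def)
  have sym: "v \<bullet> (A *v y) = a"
    using A symmetric_inner_eq[of A v y] by (simp add: psd_form_def a_def y_def)
  \<comment> \<open>Any positive \<open>s\<close> with \<open>s * b < 2 * a\<close> works; the
    \<open>+ 1\<close> keeps the denominator positive when \<open>b = 0\<close>.\<close>
  define s where "s = a / (b + 1)"
  have s: "s > 0" using a b by (simp add: s_def)
  have "0 \<le> (v - s *\<^sub>R y) \<bullet> (A *v (v - s *\<^sub>R y))"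
    using A by (simp add: psd_form_def)
  also have "\<dots> = s * (s * b - 2 * a)"
    using v sym
    by (simp add: matrix_vector_mult_diff_distrib matrix_vector_mult_scaleR inner_diff_left
        inner_diff_right b_def[symmetric] y_def[symmetric] a_def[symmetric] algebra_simps)
  finally have "2 * a \<le> s * b" using s by (simp add: zero_le_mult_iff)
  moreover have "s * b \<le> a" using a b by (simp add: s_def field_simps)
  ultimately show False using a by linarith
qed

lemma psd_form_congruence:
  fixes A V :: "real^'n^'n"
  assumes "psd_form V" and "transpose A = A"
  shows "psd_form (A ** V ** A)"
  unfolding psd_form_def
proof (intro conjI allI)
  show "transpose (A ** V ** A) = A ** V ** A"
    using assms by (simp add: psd_form_def matrix_transpose_mul matrix_mul_assoc)
  fix x
  have "x \<bullet> ((A ** V ** A) *v x) = (A *v x) \<bullet> (V *v (A *v x))"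
    using symmetric_inner_eq[OF assms(2), of x]
    by (simp add: matrix_vector_mul_assoc[symmetric])
  then show "0 \<le> x \<bullet> ((A ** V ** A) *v x)"
    using assms(1) by (simp add: psd_form_def)
qed

text \<open>Symmetry moves one factor to the other side: the form of \<open>A^q\<close> at
  \<open>u\<close> is that of \<open>A^(q-2)\<close> at \<open>A *v u\<close>, so only the exponents
  0 and 1 remain.\<close>

lemma pd_form_power_pos:
  fixes A :: "real^'n^'n"
  assumes A: "pd_form A" and "u \<noteq> 0"
  shows "0 < u \<bullet> (((*v) A ^^ q) u)"
  using \<open>u \<noteq> 0\<close>
proof (induction q arbitrary: u rule: less_induct)
  case (less q)
  consider "q = 0" | "q = 1" | r where "q = Suc (Suc r)"
    by (metis One_nat_def not0_implies_Suc)
  then show ?case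
  proof cases
    case 3
    have "0 < u \<bullet> (A *v u)" using A less.prems by (simp add: pd_form_def)
    then have "A *v u \<noteq> 0" by auto
    then have "0 < (A *v u) \<bullet> (((*v) A ^^ r) (A *v u))"
      using less.IH[of r "A *v u"] 3 by simp
    then show ?thesis
      using A 3 symmetric_inner_eq[of A u] by (simp add: pd_form_def funpow_swap1)
  qed (use A less.prems in \<open>auto simp: pd_form_def\<close>)
qed

lemma pd_form_invertible:
  assumes "pd_form A" shows "invertible A"
proof -
  have "x = 0" if "A *v x = 0" for x
    using assms that by (metis inner_zero_right less_irrefl pd_form_def)
  then show ?thesis
    by (metis invertible_left_inverse matrix_left_invertible_ker)
qed

text \<open>The smallest value of the form on the unit sphere is an eigenvalue.\<close>

lemma min_eigenvalue_exists:
  fixes A :: "real^'n^'n"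
  assumes "transpose A = A"
  obtains c where "eigenvalue A c" "\<And>x. c * (x \<bullet> x) \<le> x \<bullet> (A *v x)"
proof -
  have "continuous_on (sphere 0 1) (\<lambda>x. x \<bullet> (A *v x))"
    by (intro continuous_intros linear_continuous_on_compose matrix_vector_mul_linear)
  moreover have "sphere (0::real^'n) 1 \<noteq> {}" by simp
  ultimately obtain v where v: "v \<in> sphere 0 1"
    and min: "\<And>x. x \<in> sphere 0 1 \<Longrightarrow> v \<bullet> (A *v v) \<le> x \<bullet> (A *v x)"
    using continuous_attains_inf[OF compact_sphere, of 0 1 "\<lambda>x. x \<bullet> (A *v x)"] by auto
  define c where "c = v \<bullet> (A *v v)"
  have bound: "c * (x \<bullet> x) \<le> x \<bullet> (A *v x)" for x
  proof (cases "x = 0")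
    case False
    have "c \<le> (x /\<^sub>R norm x) \<bullet> (A *v (x /\<^sub>R norm x))"
      unfolding c_def by (rule min) (use False in simp)
    also have "\<dots> = (x \<bullet> (A *v x)) / (norm x)\<^sup>2"
      by (simp add: matrix_vector_mult_scaleR power2_eq_square field_simps)
    finally show ?thesis
      using False by (simp add: field_simps dot_square_norm)
  qed simp
  \<comment> \<open>The form of \<open>C\<close> is nonnegative and vanishes at the minimizer
    \<open>v\<close>, so \<open>v\<close> lies in the kernel of \<open>C\<close> and is an
    eigenvector of \<open>A\<close>.\<close>
  define C where "C = A - c *\<^sub>R mat 1"
  have C: "C *v x = A *v x - c *\<^sub>R x" for x
    by (simp add: C_def matrix_vector_mult_diff_rdistrib scaleR_matrix_vector_assoc[symmetric])
  have "transpose C = C"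
    using assms by (simp add: C_def transpose_def vec_eq_iff mat_def)
  then have "psd_form C"
    using bound by (simp add: psd_form_def C inner_diff_right)
  moreover have "v \<bullet> v = 1" using v by (simp add: dot_square_norm)
  then have "v \<bullet> (C *v v) = 0" by (simp add: C inner_diff_right c_def)
  ultimately have "C *v v = 0" by (rule psd_form_zero_imp_kernel)
  moreover have "v \<noteq> 0" using v by auto
  ultimately have "eigenvalue A c"
    by (auto simp: eigenvalue_def C scalar_mult_eq_scaleR)
  then show thesis using bound that by blast
qed

lemma eigenvalue_rayleigh:
  fixes A :: "real^'n^'n"
  assumes "eigenvalue A c"
  obtains v where "v \<noteq> 0" "v \<bullet> (A *v v) = c * (v \<bullet> v)"
  using assms by (auto simp: eigenvalue_def scalar_mult_eq_scaleR)

lemma positive_semidefinite_iff: "positive_semidefinite A \<longleftrightarrow> psd_form A"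
proof
  assume A: "positive_semidefinite A"
  then obtain c where "eigenvalue A c" "\<And>x. c * (x \<bullet> x) \<le> x \<bullet> (A *v x)"
    using min_eigenvalue_exists positive_semidefinite_def by blast
  with A show "psd_form A"
    unfolding positive_semidefinite_def psd_form_def
    by (meson inner_ge_zero mult_nonneg_nonneg order_trans)
next
  assume A: "psd_form A"
  have "c \<ge> 0" if "eigenvalue A c" for c
  proof -
    obtain v where "v \<noteq> 0" "v \<bullet> (A *v v) = c * (v \<bullet> v)"
      using eigenvalue_rayleigh \<open>eigenvalue A c\<close> .
    then show ?thesis using A
      by (metis inner_gt_zero_iff psd_form_def zero_le_mult_iff not_less)
  qed
  then show "positive_semidefinite A"
    using A by (simp add: positive_semidefinite_def psd_form_def)
qed

lemma positive_definite_imp_pd_form: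
  assumes A: "positive_definite A" shows "pd_form A"
proof -
  obtain c where "eigenvalue A c" "\<And>x. c * (x \<bullet> x) \<le> x \<bullet> (A *v x)"
    using min_eigenvalue_exists positive_definite_def A by blast
  with A show ?thesis
    unfolding positive_definite_def pd_form_def
    by (meson inner_gt_zero_iff mult_pos_pos order_less_le_trans)
qed

section \<open>Rank one matrices and the trace inner product\<close>

definition outer :: "real^'n \<Rightarrow> real^'n^'n" where
  "outer v = (\<chi> i j. v $ i * v $ j)"

lemma outer_mult_vec: "outer v *v x = (v \<bullet> x) *\<^sub>R v"
  by (simp add: outer_def matrix_vector_mult_def vec_eq_iff inner_vec_def sum_distrib_left
      sum_distrib_right mult_ac)

lemma inner_outer: "A \<bullet> outer v = v \<bullet> (A *v v)"
  by (simp add: outer_def matrix_vector_mult_def inner_vec_def sum_distrib_left mult_ac)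

lemma transpose_outer: "transpose (outer v) = outer v"
  by (simp add: outer_def transpose_def vec_eq_iff mult_ac)

lemma psd_form_outer: "psd_form (outer v)"
  by (simp add: psd_form_def transpose_outer outer_mult_vec inner_commute)

lemma mult_outer_eq_0:
  fixes A :: "real^'n^'n"
  assumes "A *v v = 0" shows "A ** outer v = 0"
  unfolding matrix_eq
  by (simp add: matrix_vector_mul_assoc[symmetric] outer_mult_vec matrix_vector_mult_scaleR assms)

text \<open>A step of the \<open>L D L\<^sup>T\<close> decomposition: subtracting a rank one matrix clears a column of \<open>X\<close>
  and keeps the columns that are already zero.\<close>

lemma psd_form_inner_psd_form:
  fixes A X :: "real^'n^'n"
  assumes A: "psd_form A" and "psd_form X"
  shows "0 \<le> A \<bullet> X \<and> (A \<bullet> X = 0 \<longrightarrow> A ** X = 0)"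
  using \<open>psd_form X\<close>
proof (induction "card {i. X *v axis i 1 \<noteq> 0}" arbitrary: X rule: less_induct)
  case less
  show ?case
  proof (cases "\<exists>i. X *v axis i 1 \<noteq> 0")
    case False
    then have "X = 0"
      by (simp add: matrix_vector_mult_basis column_def vec_eq_iff)
    then show ?thesis by simp
  next
    case True
    then obtain k where k: "X *v axis k 1 \<noteq> 0" by blast
    define w :: "real^'n" where "w = axis k 1"
    define u where "u = X *v w"
    define c where "c = 1 / (w \<bullet> u)"
    \<comment> \<open>This is the \<open>k\<close>-th diagonal entry of \<open>X\<close>; were it
      zero, the whole column \<open>X *v w\<close> would vanish.\<close>
    have "w \<bullet> u \<noteq> 0"
      using k psd_form_zero_imp_kernel[OF less.prems] by (auto simp: u_def w_def)
    moreover have "w \<bullet> u \<ge> 0" using less.prems by (simp add: u_def psd_form_def)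
    ultimately have wu: "w \<bullet> u > 0" by simp
    then have c: "c > 0" "c * (w \<bullet> u) = 1" by (simp_all add: c_def)
    have sym: "transpose X = X" using less.prems by (simp add: psd_form_def)
    have ux: "u \<bullet> x = w \<bullet> (X *v x)" for x
      using symmetric_inner_eq[OF sym] by (simp add: u_def)
    define Y where "Y = X - c *\<^sub>R outer u"
    have Yv: "Y *v x = X *v x - (c * (u \<bullet> x)) *\<^sub>R u" for x
      by (simp add: Y_def matrix_vector_mult_diff_rdistrib scaleR_matrix_vector_assoc[symmetric]
          outer_mult_vec)
    have "transpose Y = Y"
      using sym transpose_outer[of u] by (simp add: Y_def transpose_def vec_eq_iff)
    moreover have "0 \<le> x \<bullet> (Y *v x)" for x
    proof -
      \<comment> \<open>Completing the square: \<open>?y\<close> is \<open>x\<close> made orthogonal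
        to \<open>w\<close> for the form of \<open>X\<close>, and there that form equals the form of
        \<open>Y\<close> at \<open>x\<close>.\<close>
      let ?y = "x - (c * (u \<bullet> x)) *\<^sub>R w"
      have xu: "x \<bullet> u = u \<bullet> x" by (rule inner_commute)
      have "0 \<le> ?y \<bullet> (X *v ?y)" using less.prems by (simp add: psd_form_def)
      also have "\<dots> = x \<bullet> (X *v x) - 2 * c * (u \<bullet> x)\<^sup>2 + c * (u \<bullet> x)\<^sup>2 * (c * (w \<bullet> u))"
        by (simp add: matrix_vector_mult_diff_distrib matrix_vector_mult_scaleR inner_diff_left
            inner_diff_right ux[symmetric] u_def[symmetric] xu power2_eq_square algebra_simps)
      also have "\<dots> = x \<bullet> (Y *v x)"
        by (simp add: c Yv inner_diff_right xu power2_eq_square)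
      finally show ?thesis .
    qed
    ultimately have Y: "psd_form Y" by (simp add: psd_form_def)
    have "Y *v w = 0"
      using c by (simp add: Yv ux u_def[symmetric])
    moreover have "Y *v axis i 1 = 0" if "X *v axis i 1 = 0" for i
      using that by (simp add: Yv ux)
    ultimately have "{i. Y *v axis i 1 \<noteq> 0} \<subset> {i. X *v axis i 1 \<noteq> 0}"
      using k by (auto simp: w_def)
    then have "card {i. Y *v axis i 1 \<noteq> 0} < card {i. X *v axis i 1 \<noteq> 0}"
      by (intro psubset_card_mono) simp_all
    then have IH: "0 \<le> A \<bullet> Y" "A \<bullet> Y = 0 \<longrightarrow> A ** Y = 0"
      using less.hyps[OF _ Y] by simp_all
    have X: "X = Y + c *\<^sub>R outer u" by (simp add: Y_def)
    then have inner: "A \<bullet> X = A \<bullet> Y + c * (u \<bullet> (A *v u))"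
      by (simp add: inner_add_right inner_outer)
    have u: "0 \<le> c * (u \<bullet> (A *v u))" using A c by (simp add: psd_form_def)
    have "A ** X = 0" if "A \<bullet> X = 0"
    proof -
      have "A \<bullet> Y = 0" "u \<bullet> (A *v u) = 0"
        using that inner IH(1) u c by (auto simp: add_nonneg_eq_0_iff)
      then show ?thesis
        using IH(2) mult_outer_eq_0[OF psd_form_zero_imp_kernel[OF A]]
        by (simp add: X matrix_add_ldistrib matrix_scalar_ac scalar_matrix_assoc[symmetric])
    qed
    then show ?thesis using inner IH(1) u by simp
  qed
qed

section \<open>The closed convex cone of positive semidefinite matrices\<close>

lemma psd_form_add: "psd_form A \<Longrightarrow> psd_form B \<Longrightarrow> psd_form (A + B)"
  by (simp add: psd_form_def transpose_def vec_eq_iff matrix_vector_mult_add_rdistrib inner_add_right)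

lemma psd_form_scaleR: "psd_form A \<Longrightarrow> 0 \<le> c \<Longrightarrow> psd_form (c *\<^sub>R A)"
  by (simp add: psd_form_def transpose_scalar scaleR_matrix_vector_assoc[symmetric])

lemma psd_form_0: "psd_form 0"
  by (simp add: psd_form_def transpose_def vec_eq_iff)

lemma convex_psd_forms: "convex {A. psd_form A}"
  by (auto simp: convex_def intro: psd_form_add psd_form_scaleR)

lemma linear_matrix_vector_mult_left: "linear (\<lambda>A :: real^'n^'m. A *v x)"
  by (rule linearI)
    (simp_all add: matrix_vector_mult_add_rdistrib scaleR_matrix_vector_assoc[symmetric])

lemma closed_psd_forms: "closed {A :: real^'n^'n. psd_form A}"
proof -
  have "{A :: real^'n^'n. psd_form A} =
      (\<Inter>i. \<Inter>j. {A. A $ i $ j = A $ j $ i}) \<inter> (\<Inter>x. {A. 0 \<le> x \<bullet> (A *v x)})"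
    by (auto simp: psd_form_def transpose_def vec_eq_iff)
  moreover have "closed \<dots>"
  proof (intro closed_Int closed_INT ballI)
    show "closed {A :: real^'n^'n. A $ i $ j = A $ j $ i}" for i j
      by (intro closed_Collect_eq continuous_intros)
    show "closed {A :: real^'n^'n. 0 \<le> x \<bullet> (A *v x)}" for x
      by (intro closed_Collect_le continuous_on_const continuous_on_inner
          linear_continuous_on linear_matrix_vector_mult_left[unfolded linear_conv_bounded_linear])
  qed
  ultimately show ?thesis by simp
qed

subsection \<open>Words\<close>

lemma word_matrix_Nil [simp]: "word_matrix [] X B = mat 1"
  by (simp add: word_matrix_def)

lemma word_matrix_Cons [simp]:
  "word_matrix (l # W) X B = letter_matrix X B l ** word_matrix W X B"
  by (simp add: word_matrix_def)

lemma word_matrix_append: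
  "word_matrix (V @ W) X B = word_matrix V X B ** word_matrix W X B"
  by (induction V) (simp_all add: matrix_mul_assoc)

lemma word_matrix_scaleR:
  fixes X :: "real^'n^'n"
  shows "word_matrix W (r *\<^sub>R X) B = r ^ count_list W LX *\<^sub>R word_matrix W X B"
proof (induction W)
  case (Cons l W)
  then show ?case
    by (cases l) (simp_all add: matrix_scalar_ac scalar_matrix_assoc[symmetric])
qed simp

lemma continuous_on_matrix_mult:
  fixes f :: "'a::topological_space \<Rightarrow> real^'m^'n" and g :: "'a \<Rightarrow> real^'p^'m"
  assumes "continuous_on D f" "continuous_on D g"
  shows "continuous_on D (\<lambda>x. f x ** g x)"
  unfolding matrix_matrix_mult_def
  by (intro continuous_on_vec_lambda continuous_intros assms)

lemma continuous_on_word_matrix: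
  "continuous_on D (\<lambda>X :: real^'n^'n. word_matrix W X B)"
proof (induction W)
  case (Cons l W)
  then show ?case
    by (cases l) (simp_all add: continuous_on_matrix_mult)
qed simp

lemma palindrome_induct [consumes 1, case_names Nil single step]:
  assumes "rev W = W"
    and "Q []" and "\<And>a. Q [a]" and "\<And>a V. rev V = V \<Longrightarrow> Q V \<Longrightarrow> Q (a # V @ [a])"
  shows "Q W"
  using \<open>rev W = W\<close>
proof (induction "length W" arbitrary: W rule: less_induct)
  case less
  show ?case
  proof (cases W)
    case (Cons a U)
    show ?thesis
    proof (cases U rule: rev_cases)
      case (snoc V b)
      have "a = b" using arg_cong[OF less.prems, of hd] unfolding Cons snoc by simp
      have "rev V = V" using less.prems unfolding Cons snoc \<open>a = b\<close> by simp
      then have "Q V" by (intro less.hyps) (simp_all add: Cons snoc)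
      then have "Q (a # V @ [a])" using assms(4) \<open>rev V = V\<close> by blast
      then show ?thesis by (simp add: Cons snoc \<open>a = b\<close>)
    qed (use Cons assms(3) in simp)
  qed (use assms(2) in simp)
qed

text \<open>Each outer pair of equal letters is a congruence by a symmetric matrix; the centre is
  the identity or a single letter.\<close>

lemma psd_form_word_matrix:
  assumes "rev W = W" and "psd_form X" and "\<And>j. LB j \<in> set W \<Longrightarrow> pd_form (B j)"
  shows "psd_form (word_matrix W X B)"
  using assms(1,3)
proof (induction rule: palindrome_induct)
  case Nil
  then show ?case by (simp add: pd_form_mat_1 pd_form_imp_psd_form)
next
  case (single a)
  then show ?case using \<open>psd_form X\<close>
    by (cases a) (simp_all add: pd_form_imp_psd_form)
next
  case (step a V)
  have "transpose (letter_matrix X B a) = letter_matrix X B a"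
    using step.prems[of "case a of LB j \<Rightarrow> j"] \<open>psd_form X\<close>
    by (cases a) (simp_all add: pd_form_def psd_form_def)
  then show ?case
    using psd_form_congruence step by (simp add: word_matrix_append matrix_mul_assoc)
qed

text \<open>Local form of interlacing: distinct letters \<open>LB i\<close> and \<open>LB j\<close>
  never touch. Unlike the exponents, it passes at once to the factors met in inductions on
  words.\<close>

definition compatible :: "letter \<Rightarrow> letter \<Rightarrow> bool" where
  "compatible a b \<longleftrightarrow> a = LX \<or> b = LX \<or> a = b"

text \<open>The compression of a power of a positive definite matrix to the range of \<open>X\<close> is invertible
  on that range. The letters act on \<open>y\<close> from the right end of the word; \<open>A\<^sup>q\<close> is the block of \<open>B\<close>s
  that the next \<open>X\<close> will close.\<close>

lemma word_matrix_mult_vec: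
  fixes X :: "real^'n^'n"
  assumes X: "psd_form X" and y: "X *v y \<noteq> 0"
    and "\<And>j. LB j \<in> set W \<Longrightarrow> pd_form (B j)"
    and "successively compatible W" and "W \<noteq> []" and "last W = LX"
  shows "\<exists>A q z. pd_form A \<and> X *v z \<noteq> 0 \<and> word_matrix W X B *v y = ((*v) A ^^ q) (X *v z)
           \<and> (\<forall>j. hd W = LB j \<longrightarrow> A = B j) \<and> (hd W = LX \<longrightarrow> q = 0)"
  using assms(3-)
proof (induction W)
  case (Cons l W)
  show ?case
  proof (cases "W = []")
    case True
    \<comment> \<open>An empty block follows the last \<open>X\<close>, so \<open>mat 1\<close> with
      exponent 0 is a mere placeholder.\<close>
    then have "word_matrix (l # W) X B *v y = ((*v) (mat 1) ^^ 0) (X *v y)" "l = LX"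
      using Cons.prems by simp_all
    then show ?thesis using y pd_form_mat_1
      by (intro exI[of _ "mat 1"] exI[of _ 0] exI[of _ y]) auto
  next
    case False
    have "\<exists>A q z. pd_form A \<and> X *v z \<noteq> 0 \<and> word_matrix W X B *v y = ((*v) A ^^ q) (X *v z)
           \<and> (\<forall>j. hd W = LB j \<longrightarrow> A = B j) \<and> (hd W = LX \<longrightarrow> q = 0)"
      using Cons.prems False by (intro Cons.IH) (auto simp: successively_Cons)
    then obtain A q z where A: "pd_form A" and z: "X *v z \<noteq> 0"
      and W: "word_matrix W X B *v y = ((*v) A ^^ q) (X *v z)"
      and hd: "\<forall>j. hd W = LB j \<longrightarrow> A = B j" "hd W = LX \<longrightarrow> q = 0" by blast
    show ?thesis
    proof (cases l)
      case LX
      let ?u = "((*v) A ^^ q) (X *v z)"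
      have "0 < (X *v z) \<bullet> ?u" by (rule pd_form_power_pos[OF A z])
      also have "\<dots> = z \<bullet> (X *v ?u)"
        using X by (intro symmetric_inner_eq) (simp add: psd_form_def)
      finally have "X *v ?u \<noteq> 0" by auto
      moreover have "word_matrix (l # W) X B *v y = ((*v) A ^^ 0) (X *v ?u)"
        by (simp add: LX matrix_vector_mul_assoc[symmetric] W)
      ultimately show ?thesis using A LX
        by (intro exI[of _ A] exI[of _ 0] exI[of _ ?u]) auto
    next
      case (LB i)
      have "compatible (LB i) (hd W)"
        using Cons.prems(2) False LB by (simp add: successively_Cons)
      \<comment> \<open>Either \<open>W\<close> starts with \<open>X\<close> and
        \<open>q = 0\<close>, so the base is immaterial, or it starts with the same letter
        \<open>LB i\<close> and \<open>A = B i\<close>.\<close>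
      then have "((*v) A ^^ q) (X *v z) = ((*v) (B i) ^^ q) (X *v z)"
        using hd by (cases "hd W") (auto simp: compatible_def)
      then have "word_matrix (l # W) X B *v y = ((*v) (B i) ^^ Suc q) (X *v z)"
        by (simp add: LB matrix_vector_mul_assoc[symmetric] W)
      moreover have "pd_form (B i)" using Cons.prems LB by simp
      ultimately show ?thesis using z LB
        by (intro exI[of _ "B i"] exI[of _ "Suc q"] exI[of _ z]) auto
    qed
  qed
qed simp

lemma word_matrix_mult_vec_nonzero:
  fixes X :: "real^'n^'n"
  assumes "psd_form X" "X *v y \<noteq> 0" "\<And>j. LB j \<in> set W \<Longrightarrow> pd_form (B j)"
    "successively compatible W" "W \<noteq> []" "last W = LX"
  shows "word_matrix W X B *v y \<noteq> 0"
proof -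
  obtain A q z where "pd_form A" "X *v z \<noteq> 0"
    and W: "word_matrix W X B *v y = ((*v) A ^^ q) (X *v z)"
    using word_matrix_mult_vec[of X y W B] assms by blast
  then have "0 < (X *v z) \<bullet> (word_matrix W X B *v y)"
    using pd_form_power_pos by metis
  then show ?thesis by auto
qed

lemma interlaced_imp_compatible:
  assumes "interlaced k W"
  shows "successively compatible W" "LX \<in> set W" "\<And>j. LB j \<in> set W \<Longrightarrow> j \<in> {1..k}"
proof -
  obtain m i p q where m: "m \<ge> 1" and i: "\<forall>j\<in>{1..m+1}. i j \<in> {1..k}"
    and p: "\<forall>j\<in>{1..m}. (p j :: nat) > 0"
    and W: "W = replicate (q 1) (LB (i 1)) @
            concat (map (\<lambda>j. replicate (p j) LX @ replicate (q (j+1)) (LB (i (j+1)))) [1..<m+1])"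
    using assms unfolding interlaced_def by blast
  have rep: "successively compatible (replicate r a)" for r a
    by (induction r) (auto simp: successively_Cons compatible_def hd_replicate)
  have LX: "compatible LX a" "compatible a LX" for a by (simp_all add: compatible_def)
  show "successively compatible W"
    unfolding W using p
  \<comment> \<open>The base case is \<open>m = 0\<close>, where the word is a single block of one
    letter.\<close>
  proof (induction m)
    case (Suc m)
    let ?V = "replicate (q 1) (LB (i 1)) @
            concat (map (\<lambda>j. replicate (p j) LX @ replicate (q (j+1)) (LB (i (j+1)))) [1..<m+1])"
    let ?U = "replicate (p (Suc m)) LX @ replicate (q (Suc m + 1)) (LB (i (Suc m + 1)))"
    have "successively compatible ?V" using Suc by simp
    moreover have "successively compatible ?U"
      by (cases "p (Suc m)") (simp_all add: successively_append_iff rep LX del: replicate_Suc)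
    \<comment> \<open>A positive exponent puts an \<open>X\<close> between the old last block and
      the new one.\<close>
    moreover have "p (Suc m) > 0" using Suc.prems by (rule bspec) simp
    then have "hd ?U = LX" by (simp add: hd_append)
    ultimately have "successively compatible (?V @ ?U)"
      by (subst successively_append_iff) (simp only: LX, simp)
    then show ?case by simp
  qed (simp add: rep)
  have "1 \<in> set [1..<m+1]" "p 1 > 0" using m p by auto
  then show "LX \<in> set W" unfolding W by auto
  show "j \<in> {1..k}" if "LB j \<in> set W" for j
    using that i unfolding W by (auto split: if_splits)
qed

subsection \<open>Solving the equation\<close>

text \<open>A zero of the projected vector field \<open>P - S(X)\<close> on the truncated cone, obtained from Brouwer's
  theorem, is a solution of the complementarity problem once the truncation is inactive.\<close>

lemma complementarity:
  fixes F :: "real^'n^'n \<Rightarrow> real^'n^'n"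
  assumes F: "continuous_on UNIV F" and R: "R > 0"
    and out: "\<And>X. psd_form X \<Longrightarrow> norm X = R \<Longrightarrow> 0 < F X \<bullet> X"
  obtains X where "psd_form X" "F X \<bullet> X = 0" "\<And>Z. psd_form Z \<Longrightarrow> 0 \<le> F X \<bullet> Z"
proof -
  define D where "D = {X :: real^'n^'n. psd_form X} \<inter> cball 0 R"
  have D: "convex D" "closed D" "compact D" "0 \<in> D"
    using R by (auto simp: D_def convex_psd_forms closed_psd_forms convex_Int psd_form_0
        closed_Int_compact)
  \<comment> \<open>A fixed point of this map is a point where the projected field vanishes; the
    obtuse angle property of the projection turns it into the variational inequality
    \<open>vi\<close>.\<close>
  have "continuous_on D (\<lambda>X. closest_point D (X - F X))"
  proof (rule continuous_on_compose2[where g = "closest_point D" and t = UNIV])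
    show "continuous_on UNIV (closest_point D)"
      using D by (intro continuous_on_closest_point) auto
    show "continuous_on D (\<lambda>X. X - F X)"
      by (intro continuous_intros continuous_on_subset[OF F]) auto
  qed simp
  moreover have "(\<lambda>X. closest_point D (X - F X)) \<in> D \<rightarrow> D"
    using D by (auto intro: closest_point_in_set)
  ultimately obtain X where X: "X \<in> D" "closest_point D (X - F X) = X"
    using brouwer[of D] D by blast
  have vi: "0 \<le> F X \<bullet> (Y - X)" if "Y \<in> D" for Y
    using closest_point_dot[OF D(1,2) that, of "X - F X"] X by simp
  have psd: "psd_form X" and "norm X \<le> R" using X by (auto simp: D_def)
  have le: "F X \<bullet> X \<le> 0" using vi[OF D(4)] by simp
  \<comment> \<open>On the sphere \<open>out\<close> would contradict \<open>le\<close>, so the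
    truncation is inactive.\<close>
  then have "norm X < R" using out[OF psd] \<open>norm X \<le> R\<close> by fastforce
  have Z: "0 \<le> F X \<bullet> Z" if "psd_form Z" for Z
  proof -
    \<comment> \<open>Chosen so that \<open>X + e *\<^sub>R Z\<close> stays in the ball; the
      \<open>+ 1\<close> covers \<open>Z = 0\<close>.\<close>
    define e where "e = (R - norm X) / (norm Z + 1)"
    have e: "e > 0" using \<open>norm X < R\<close>
      by (simp add: e_def add_nonneg_pos)
    have "e * norm Z \<le> e * (norm Z + 1)" using e by simp
    also have "\<dots> = R - norm X"
      using add_nonneg_pos[OF norm_ge_zero zero_less_one, of Z] by (simp add: e_def)
    finally have "norm (X + e *\<^sub>R Z) \<le> R"
      using e norm_triangle_ineq[of X "e *\<^sub>R Z"] by simp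
    moreover have "psd_form (X + e *\<^sub>R Z)"
      using psd that e by (simp add: psd_form_add psd_form_scaleR)
    ultimately have "0 \<le> F X \<bullet> (e *\<^sub>R Z)" using vi[of "X + e *\<^sub>R Z"] by (simp add: D_def)
    then show ?thesis using e by (simp add: zero_le_mult_iff)
  qed
  then show thesis using that psd le by (metis order_antisym)
qed

text \<open>A zero inner product would force \<open>S(X) X = 0\<close>, but the word
  \<open>S @ [LX]\<close> is still compatible and ends in \<open>X\<close>, so it kills no vector
  outside the kernel of \<open>X\<close>.\<close>

lemma word_matrix_inner_pos:
  fixes X :: "real^'n^'n"
  assumes S: "rev S = S" "successively compatible S" "S \<noteq> []" "hd S = LX"
    and B: "\<And>j. LB j \<in> set S \<Longrightarrow> pd_form (B j)"
    and X: "psd_form X" "X \<noteq> 0"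
  shows "0 < word_matrix S X B \<bullet> X"
proof -
  obtain y where y: "X *v y \<noteq> 0" using X(2) by (metis matrix_eq matrix_vector_mult_0)
  have "last S = LX" using S by (metis hd_rev)
  then have "word_matrix (S @ [LX]) X B *v y \<noteq> 0"
    using S B y by (intro word_matrix_mult_vec_nonzero X(1))
      (auto simp: successively_append_iff compatible_def)
  then have "word_matrix S X B ** X \<noteq> 0"
    by (auto simp: word_matrix_append)
  then show ?thesis
    using psd_form_inner_psd_form[OF psd_form_word_matrix[where B = B, OF S(1) X(1) B] X(1)]
    by (metis order_less_le)
qed

text \<open>The right side is homogeneous of degree at least 2 in \<open>X\<close> and bounded below
  by a positive constant on the compact unit slice of the cone, so it outgrows the linear left
  side.\<close>

lemma word_matrix_inner_coercive:
  fixes B :: "nat \<Rightarrow> real^'n^'n"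
  assumes S: "rev S = S" "successively compatible S" "S \<noteq> []" "hd S = LX"
    and B: "\<And>j. LB j \<in> set S \<Longrightarrow> pd_form (B j)"
  obtains R where "R > 0"
    "\<And>X. psd_form X \<Longrightarrow> norm X = R \<Longrightarrow> b * R < word_matrix S X B \<bullet> X"
proof -
  define K where "K = {X :: real^'n^'n. psd_form X} \<inter> sphere 0 1"
  have "compact K" by (simp add: K_def closed_psd_forms closed_Int_compact)
  have "\<exists>c>0. \<forall>X\<in>K. c \<le> word_matrix S X B \<bullet> X"
  proof (cases "K = {}")
    case False
    have "continuous_on K (\<lambda>X. word_matrix S X B \<bullet> X)"
      by (intro continuous_on_inner continuous_on_word_matrix continuous_on_id)
    then obtain X0 where X0: "X0 \<in> K" "\<forall>X\<in>K. word_matrix S X0 B \<bullet> X0 \<le> word_matrix S X B \<bullet> X"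
      using continuous_attains_inf[OF \<open>compact K\<close> False] by blast
    moreover have "0 < word_matrix S X0 B \<bullet> X0"
      using X0(1) by (intro word_matrix_inner_pos[where B = B, OF S B]) (auto simp: K_def)
    ultimately show ?thesis by blast
  qed (auto intro: exI[of _ 1])
  then obtain c where c: "c > 0" "\<And>X. X \<in> K \<Longrightarrow> c \<le> word_matrix S X B \<bullet> X" by blast
  \<comment> \<open>The bound 1 gives \<open>R \<le> R ^ m\<close>; the other bound gives
    \<open>c * R > b\<close>, strictly because of the \<open>+ 1\<close>.\<close>
  define R where "R = max 1 ((\<bar>b\<bar> + 1) / c)"
  have R: "R \<ge> 1" "c * R > b"
  proof -
    have "(\<bar>b\<bar> + 1) / c \<le> R" by (simp add: R_def)
    then show "c * R > b" using c(1) by (simp add: field_simps)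
  qed (simp add: R_def)
  define m where "m = count_list S LX"
  have "m \<ge> 1" using S(3,4) by (cases S) (simp_all add: m_def)
  have "b * R < word_matrix S X B \<bullet> X" if X: "psd_form X" "norm X = R" for X
  proof -
    define U where "U = (1 / R) *\<^sub>R X"
    have U: "U \<in> K" and XU: "X = R *\<^sub>R U"
      using X R by (auto simp: K_def U_def psd_form_scaleR)
    have "b * R < c * R * R" using R by simp
    also have "\<dots> \<le> c * R ^ m * R"
      using R c \<open>m \<ge> 1\<close> power_increasing[of 1 m R] by simp
    also have "\<dots> \<le> (word_matrix S U B \<bullet> U) * R ^ m * R"
      using c(2)[OF U] R by (intro mult_right_mono) auto
    also have "\<dots> = word_matrix S X B \<bullet> X"
      by (simp add: XU word_matrix_scaleR m_def mult_ac)
    finally show ?thesis .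
  qed
  then show thesis using that R by (meson less_le_trans zero_less_one)
qed

lemma word_equation_hd_LX:
  fixes B :: "nat \<Rightarrow> real^'n^'n"
  assumes S: "rev S = S" "successively compatible S" "S \<noteq> []" "hd S = LX"
    and B: "\<And>j. LB j \<in> set S \<Longrightarrow> pd_form (B j)"
    and P: "psd_form P"
  shows "\<exists>X. psd_form X \<and> word_matrix S X B = P"
proof -
  obtain R where R: "R > 0"
    "\<And>X. psd_form X \<Longrightarrow> norm X = R \<Longrightarrow> norm P * R < word_matrix S X B \<bullet> X"
    using word_matrix_inner_coercive[where B = B and b = "norm P", OF S B] by blast
  let ?F = "\<lambda>X. word_matrix S X B - P"
  have out: "0 < ?F X \<bullet> X" if "psd_form X" "norm X = R" for X
    using R(2)[OF that] norm_cauchy_schwarz[of P X] that(2) by (simp add: inner_diff_left)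
  have "continuous_on UNIV ?F"
    by (intro continuous_intros continuous_on_word_matrix)
  then obtain X where X: "psd_form X" "?F X \<bullet> X = 0" "\<And>Z. psd_form Z \<Longrightarrow> 0 \<le> ?F X \<bullet> Z"
    using complementarity[OF _ R(1) out] by blast
  define N where "N = ?F X"
  have "psd_form (word_matrix S X B)"
    by (intro psd_form_word_matrix S(1) X(1) B)
  then have "transpose N = N"
    using P by (simp add: N_def psd_form_def transpose_def vec_eq_iff)
  \<comment> \<open>Testing against the rank one matrices \<open>outer w\<close> recovers the
    quadratic form of \<open>N\<close>.\<close>
  moreover have "0 \<le> w \<bullet> (N *v w)" for w
    using X(3)[OF psd_form_outer[of w]] by (simp add: inner_outer N_def)
  ultimately have N: "psd_form N" by (simp add: psd_form_def)
  then have NX: "N ** X = 0"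
    using psd_form_inner_psd_form[OF N X(1)] X(2) by (simp add: N_def)
  obtain V where V: "S = V @ [LX]"
    using S by (metis append_butlast_last_id hd_rev)
  have ker: "N *v w = 0" if w: "X *v w = 0" for w
  proof -
    have "word_matrix S X B *v w = 0"
      by (simp add: V word_matrix_append matrix_vector_mul_assoc[symmetric] w)
    then have "N *v w = - (P *v w)"
      by (simp add: N_def matrix_vector_mult_diff_rdistrib)
    then have "w \<bullet> (N *v w) \<le> 0" using P by (simp add: psd_form_def)
    then show ?thesis
      using N psd_form_zero_imp_kernel[OF N] by (metis order_antisym psd_form_def)
  qed
  have "X ** N = transpose (N ** X)"
    using N X(1) by (simp add: psd_form_def matrix_transpose_mul)
  then have "X ** N = 0" using NX by (simp add: transpose_def vec_eq_iff)
  \<comment> \<open>The range of \<open>N\<close> lies in the kernel of \<open>X\<close>, on which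
    \<open>N\<close> vanishes; thus \<open>N\<close> squares to zero and, being symmetric, is
    zero.\<close>
  have "N *v v = 0" for v
  proof -
    have "X *v (N *v v) = 0"
      by (simp add: matrix_vector_mul_assoc \<open>X ** N = 0\<close>)
    then have "N *v (N *v v) = 0" by (rule ker)
    then have "(N *v v) \<bullet> (N *v v) = 0"
      using N symmetric_inner_eq[of N v "N *v v"] by (simp add: psd_form_def)
    then show ?thesis by simp
  qed
  then have "N = 0" by (simp add: matrix_eq)
  then show ?thesis using X(1) by (auto simp: N_def)
qed

text \<open>\<open>P\<close> varies in the induction because peeling off \<open>LB j\<close>
  replaces it by \<open>C ** P ** C\<close> with \<open>C\<close> the inverse of \<open>B j\<close>;
  the peeling stops at an outer \<open>X\<close>.\<close>

lemma word_equation: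
  fixes B :: "nat \<Rightarrow> real^'n^'n"
  assumes "rev S = S" "successively compatible S" "LX \<in> set S"
    and "\<And>j. LB j \<in> set S \<Longrightarrow> pd_form (B j)" and "psd_form P"
  shows "\<exists>X. psd_form X \<and> word_matrix S X B = P"
  using assms
proof (induction arbitrary: P rule: palindrome_induct)
  case (single a)
  then show ?case by auto
next
  case (step a V)
  show ?case
  proof (cases a)
    case LX
    then show ?thesis using step.prems step.hyps by (intro word_equation_hd_LX) simp_all
  next
    case (LB j)
    then have Bj: "pd_form (B j)" using step.prems by simp
    then obtain C where C: "B j ** C = mat 1" "C ** B j = mat 1"
      using pd_form_invertible invertible_def by blast
    \<comment> \<open>The inverse of a symmetric matrix is symmetric, so multiplying by
      \<open>C\<close> on both sides is a congruence.\<close>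
    have "transpose C = transpose C ** (B j ** C)" by (simp add: C)
    also have "\<dots> = transpose (B j ** C) ** C"
      using Bj by (simp add: matrix_transpose_mul matrix_mul_assoc pd_form_def)
    finally have symC: "transpose C = C" by (simp add: C)
    have "\<exists>X. psd_form X \<and> word_matrix V X B = C ** P ** C"
      using step.prems LB psd_form_congruence[OF \<open>psd_form P\<close> symC]
      by (intro step.IH) (auto simp: successively_Cons successively_append_iff)
    then obtain X where X: "psd_form X" "word_matrix V X B = C ** P ** C" by blast
    have "word_matrix (a # V @ [a]) X B = (B j ** C) ** P ** (C ** B j)"
      by (simp add: LB word_matrix_append X matrix_mul_assoc)
    then show ?thesis using X(1) C by auto
  qed
qed simp

theorem corollary1p7:
  fixes k :: nat and S :: word
    and B :: "nat \<Rightarrow> real^'n^'n" and P :: "real^'n^'n"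
  assumes "k \<ge> 1"
    and "interlaced k S"
    and "symmetric_word S"
    and "\<forall>j\<in>{1..k}. positive_definite (B j)"
    and "positive_semidefinite P"
  shows "\<exists>X :: real^'n^'n. positive_semidefinite X \<and> word_matrix S X B = P"
proof -
  have "pd_form (B j)" if "LB j \<in> set S" for j
    using assms(4) interlaced_imp_compatible(3)[OF assms(2) that]
    by (blast intro: positive_definite_imp_pd_form)
  then show ?thesis
    using assms interlaced_imp_compatible(1,2)[OF assms(2)] word_equation[of S B P]
    by (simp add: positive_semidefinite_iff symmetric_word_def)
qed

end
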